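(* Let $\theta_1,\theta_2>0$ with $\theta_1<2\theta_2$ and $\theta_2<2\theta_1$, and let $H:\mathbb{R}_+^2\to\mathbb{R}_+^2$ be $$H(x_1,x_2)=\Big(\tfrac{\theta_1x_1}{2}(x_1+2x_2),\ \tfrac{\theta_2x_2}{2}(x_2+2x_1)\Big).$$ Then the vector $\big(1,-\tfrac{\theta_2}{\theta_1}\big)$ is a tangent vector, at the saddle fixed point $\overline{E}=\big(\tfrac{4\theta_1-2\theta_2}{3\theta_1\theta_2},\tfrac{4\theta_2-2\theta_1}{3\theta_1\theta_2}\big)$, of the stable curve of $\overline{E}$.
   Context: $\mathbb{R}_+^2=\{(x_1,x_2): x_1\ge0,\ x_2\ge0\}$. The stable curve (stable manifold) of $\overline{E}$ is the set of points $x\in\mathbb{R}_+^2$ with $H^m(x)\to\overline{E}$ as $m\to\infty$, where $H^m$ is the $m$-th iterate. *)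

theory Defs
  imports "HOL-Analysis.Analysis"
begin

definition quadrant :: "(real \<times> real) set" where
  "quadrant = {(x\<^sub>1, x\<^sub>2). x\<^sub>1 \<ge> 0 \<and> x\<^sub>2 \<ge> 0}"

text \<open>The formula makes sense on the whole plane; only its restriction to the invariant set
  \<^const>\<open>quadrant\<close> is of interest.\<close>

definition H :: "real \<Rightarrow> real \<Rightarrow> real \<times> real \<Rightarrow> real \<times> real" where
  "H \<theta>\<^sub>1 \<theta>\<^sub>2 = (\<lambda>(x\<^sub>1, x\<^sub>2).
     (\<theta>\<^sub>1 * x\<^sub>1 / 2 * (x\<^sub>1 + 2 * x\<^sub>2), \<theta>\<^sub>2 * x\<^sub>2 / 2 * (x\<^sub>2 + 2 * x\<^sub>1)))"

lemma H_quadrant: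
  assumes "\<theta>\<^sub>1 > 0" "\<theta>\<^sub>2 > 0" "x \<in> quadrant"
  shows "H \<theta>\<^sub>1 \<theta>\<^sub>2 x \<in> quadrant"
  using assms by (auto simp: quadrant_def H_def)

definition E_bar :: "real \<Rightarrow> real \<Rightarrow> real \<times> real" where
  "E_bar \<theta>\<^sub>1 \<theta>\<^sub>2 =
     ((4 * \<theta>\<^sub>1 - 2 * \<theta>\<^sub>2) / (3 * \<theta>\<^sub>1 * \<theta>\<^sub>2), (4 * \<theta>\<^sub>2 - 2 * \<theta>\<^sub>1) / (3 * \<theta>\<^sub>1 * \<theta>\<^sub>2))"

definition stable_curve :: "'a::topological_space set \<Rightarrow> ('a \<Rightarrow> 'a) \<Rightarrow> 'a \<Rightarrow> 'a set" where
  "stable_curve D F p = {x \<in> D. (\<lambda>m. (F ^^ m) x) \<longlonglongrightarrow> p}"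

text \<open>In the plane, an eigenvalue inside and an eigenvalue outside the unit circle exhaust the
  spectrum of the derivative and are automatically real.\<close>

definition saddle_fixed_point :: "(real \<times> real \<Rightarrow> real \<times> real) \<Rightarrow> real \<times> real \<Rightarrow> bool" where
  "saddle_fixed_point F p \<longleftrightarrow> F p = p \<and>
     (\<exists>L. (F has_derivative L) (at p) \<and>
       (\<exists>\<alpha> \<beta> v w. \<bar>\<alpha>\<bar> < 1 \<and> 1 < \<bar>\<beta>\<bar> \<and>
          v \<noteq> 0 \<and> L v = \<alpha> *\<^sub>R v \<and> w \<noteq> 0 \<and> L w = \<beta> *\<^sub>R w))"

text \<open>Near \<open>p\<close> the set \<open>C\<close> must be an embedded regular \<open>C\<^sup>1\<close> curve passing through \<open>p\<close>, and \<open>v\<close>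
  must lie in its tangent line there. The neighbourhood \<open>U\<close> ensures that \<open>\<gamma>\<close> parametrizes all of
  \<open>C\<close> near \<open>p\<close>, not merely some arc inside \<open>C\<close>.\<close>

definition tangent_vector_of_curve ::
    "'a::real_normed_vector set \<Rightarrow> 'a \<Rightarrow> 'a \<Rightarrow> bool" where
  "tangent_vector_of_curve C p v \<longleftrightarrow>
     (\<exists>\<epsilon>>0. \<exists>\<gamma> \<delta> U.
        open U \<and> homeomorphism {-\<epsilon><..<\<epsilon>} (C \<inter> U) \<gamma> \<delta> \<and>
        \<gamma> C1_differentiable_on {-\<epsilon><..<\<epsilon>} \<and>
        (\<forall>t\<in>{-\<epsilon><..<\<epsilon>}. vector_derivative \<gamma> (at t) \<noteq> 0) \<and>
        \<gamma> (0::real) = p \<and>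
        (\<exists>c. v = c *\<^sub>R vector_derivative \<gamma> (at 0)))"

end

theory Submission
  imports Defs
begin

text \<open>In the coordinates \<open>a = ln x\<^sub>1\<close>, \<open>s = ln (x\<^sub>2 / x\<^sub>1)\<close> the map \<open>H\<close>, being homogeneous of
  degree 2, is the skew product \<open>(a, s) \<mapsto> (2 a + \<phi> s, h s)\<close>, where \<open>h\<close> has the fixed point \<open>s\<^sup>* = ln r\<close> and
  \<open>0 < h' < 1\<close>. The series \<open>A s = - (\<Sum>k. \<phi> (h\<^sup>k s) / 2\<^sup>k\<^sup>+\<^sup>1)\<close> is \<open>C\<^sup>1\<close> and satisfies
  \<open>A (h s) = 2 A s + \<phi> s\<close>, so \<open>a - A s\<close> doubles at every step: the stable curve is the graph
  \<open>a = A s\<close>. Differentiating the functional equation at \<open>s\<^sup>*\<close> gives its tangent.\<close>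

section \<open>A continuously differentiable solution of the cohomological equation\<close>

text \<open>The chain rule brings in only products of values of \<open>h'\<close>, all of modulus at
  most 1. The differentiated series is thus dominated by a geometric one and may be summed
  termwise.\<close>

lemma cohomological_equation:
  fixes h h' \<phi> \<phi>' :: "real \<Rightarrow> real"
  assumes h: "\<And>s. (h has_real_derivative h' s) (at s)" "continuous_on UNIV h'" "\<And>s. \<bar>h' s\<bar> \<le> 1"
    and \<phi>: "\<And>s. (\<phi> has_real_derivative \<phi>' s) (at s)" "continuous_on UNIV \<phi>'" "\<And>s. \<bar>\<phi>' s\<bar> \<le> B"
    and fixpt: "h p = p"
  obtains A A' where "\<And>s. (A has_real_derivative A' s) (at s)" "continuous_on UNIV A'"
    "\<And>s. A (h s) = 2 * A s + \<phi> s"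
proof -
  define D where "D k s = (\<Prod>j<k. h' ((h ^^ j) s))" for k s
  have iter: "((h ^^ k) has_real_derivative D k s) (at s)" for k s
  proof (induction k)
    case 0
    then show ?case by (simp add: D_def id_def)
  next
    case (Suc k)
    have "((\<lambda>x. h ((h ^^ k) x)) has_real_derivative h' ((h ^^ k) s) * D k s) (at s)"
      by (rule DERIV_chain2[OF h(1) Suc])
    then show ?case by (simp add: D_def o_def mult.commute)
  qed
  have cont_iter: "continuous_on UNIV (h ^^ k)" for k
    by (intro continuous_at_imp_continuous_on ballI DERIV_isCont[OF iter])
  have cont_D: "continuous_on UNIV (D k)" for k
    unfolding D_def
    by (intro continuous_on_prod continuous_on_compose2[OF h(2)] cont_iter) auto
  have D_le: "\<bar>D k s\<bar> \<le> 1" for k s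
    unfolding D_def abs_prod by (intro prod_le_1) (auto simp: h(3))
  \<comment> \<open>Solving the equation for \<open>A s\<close> gives
    \<open>A s = (A (h s) - \<phi> s) / 2\<close>. Iterating this produces these terms, each round
    contributing one more halving.\<close>
  define f where "f k s = - \<phi> ((h ^^ k) s) / 2 ^ Suc k" for k s
  define f' where "f' k s = - (\<phi>' ((h ^^ k) s) * D k s) / 2 ^ Suc k" for k s
  have f: "(f k has_real_derivative f' k s) (at s)" for k s
    unfolding f_def f'_def
    by (intro DERIV_cdivide DERIV_minus DERIV_chain2[OF \<phi>(1) iter])
  have cont_f': "continuous_on UNIV (f' k)" for k
    unfolding f'_def
    by (intro continuous_intros continuous_on_compose2[OF \<phi>(2)] cont_iter cont_D) auto
  have f'_le: "norm (f' k s) \<le> B * (1/2) ^ Suc k" for k s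
  proof -
    have "\<bar>\<phi>' ((h ^^ k) s) * D k s\<bar> \<le> B * 1"
      unfolding abs_mult using \<phi>(3) D_le by (intro mult_mono) (auto intro: order_trans[OF abs_ge_zero])
    then show ?thesis
      by (simp add: f'_def abs_mult field_simps power_one_over)
  qed
  have geo: "summable (\<lambda>k. b * (1/2::real) ^ Suc k)" for b
    by (intro summable_mult summable_Suc_iff[THEN iffD2] summable_geometric) auto
  have "uniform_limit UNIV (\<lambda>n s. \<Sum>k<n. f' k s) (\<lambda>s. \<Sum>k. f' k s) sequentially"
    by (rule Weierstrass_m_test[OF f'_le geo])
  then have cont: "continuous_on UNIV (\<lambda>s. \<Sum>k. f' k s)"
    by (rule uniform_limit_theorem[rotated])
       (auto intro!: always_eventually continuous_on_sum cont_f')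
  have unif: "uniformly_convergent_on UNIV (\<lambda>n s. \<Sum>k<n. f' k s)"
    by (rule Weierstrass_m_test'[OF f'_le geo])
  \<comment> \<open>Termwise differentiation needs one point where the series itself converges; at
    the fixed point it is geometric.\<close>
  have "(h ^^ k) p = p" for k
    by (induction k) (auto simp: fixpt)
  then have "summable (\<lambda>k. f k p)"
    using geo[of "- \<phi> p"] by (simp add: f_def power_one_over)
  note ser = has_field_derivative_series'[OF convex_UNIV f unif UNIV_I this, simplified]
  \<comment> \<open>Passing from \<open>s\<close> to \<open>h s\<close> shifts the index and doubles
    each term; the dropped term \<open>f 0 s = - \<phi> s / 2\<close> accounts for
    \<open>\<phi> s\<close>.\<close>
  have "(\<Sum>k. f k (h s)) = 2 * (\<Sum>k. f k s) + \<phi> s" for s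
  proof -
    have "(\<Sum>k. f k (h s)) = (\<Sum>k. 2 * f (Suc k) s)"
      by (intro suminf_cong) (simp add: f_def funpow_Suc_right del: funpow.simps)
    also have "\<dots> = 2 * (\<Sum>k. f (Suc k) s)"
      using ser(1)[of s] summable_Suc_iff[of "\<lambda>k. f k s"] by (intro suminf_mult) simp
    also have "\<dots> = 2 * ((\<Sum>k. f k s) - f 0 s)"
      by (simp add: suminf_split_head[OF ser(1)])
    finally show ?thesis by (simp add: f_def)
  qed
  then show thesis
    using that[OF ser(2) cont] by blast
qed

section \<open>Global attraction to a fixed point on the line\<close>

text \<open>The derivative may approach modulus 1 at infinity, so a uniform contraction constant is
  sought only on the compact ball around \<open>p\<close> reaching to \<open>s\<close>. Moving
  closer to \<open>p\<close>, the orbit never leaves it.\<close>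

lemma funpow_tendsto_fixed_point:
  fixes h h' :: "real \<Rightarrow> real"
  assumes h: "\<And>s. (h has_real_derivative h' s) (at s)" "continuous_on UNIV h'" "\<And>s. \<bar>h' s\<bar> < 1"
    and fixpt: "h p = p"
  shows "(\<lambda>k. (h ^^ k) s) \<longlonglongrightarrow> p"
proof -
  define R where "R = \<bar>s - p\<bar>"
  obtain m where m: "m \<in> cball p R" "\<And>x. x \<in> cball p R \<Longrightarrow> \<bar>h' x\<bar> \<le> \<bar>h' m\<bar>"
  proof -
    have "continuous_on (cball p R) (\<lambda>x. \<bar>h' x\<bar>)"
      by (intro continuous_intros continuous_on_subset[OF h(2)]) auto
    then show thesis
      using continuous_attains_sup[OF compact_cball] that by (metis R_def abs_ge_zero cball_eq_empty not_le)
  qed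
  define q where "q = \<bar>h' m\<bar>"
  have q: "0 \<le> q" "q < 1"
    by (auto simp: q_def h(3))
  have step: "\<bar>h x - p\<bar> \<le> q * \<bar>x - p\<bar>" if "x \<in> cball p R" for x
  proof -
    have "norm (h x - h p) \<le> q * norm (x - p)"
      using that m(2) R_def
      by (intro field_differentiable_bound[of "cball p R" h h'])
         (auto simp: q_def intro: has_field_derivative_at_within h(1))
    then show ?thesis by (simp add: fixpt)
  qed
  have bound: "\<bar>(h ^^ k) s - p\<bar> \<le> q ^ k * R" for k
  proof (induction k)
    case (Suc k)
    have "q ^ k * R \<le> 1 * R"
      using q by (intro mult_right_mono power_le_one) (auto simp: R_def)
    with Suc have "(h ^^ k) s \<in> cball p R"
      by (auto simp: dist_real_def)
    from step[OF this] have "\<bar>(h ^^ Suc k) s - p\<bar> \<le> q * \<bar>(h ^^ k) s - p\<bar>"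
      by simp
    also have "\<dots> \<le> q * (q ^ k * R)"
      by (intro mult_left_mono Suc q)
    finally show ?case by simp
  qed (simp add: R_def)
  have "(\<lambda>k. q ^ k * R) \<longlonglongrightarrow> 0"
    using q by (intro tendsto_mult_left_zero LIMSEQ_power_zero) auto
  then have "(\<lambda>k. (h ^^ k) s - p) \<longlonglongrightarrow> 0"
    by (rule Lim_null_comparison[OF always_eventually, rotated])
       (unfold real_norm_def, intro allI bound)
  then show ?thesis by (rule LIM_zero_cancel)
qed

section \<open>The map in logarithmic coordinates\<close>

definition log_point :: "real \<Rightarrow> real \<Rightarrow> real \<times> real" where
  "log_point a s = (exp a, exp (a + s))"

definition log_slope :: "real \<times> real \<Rightarrow> real" where
  "log_slope x = ln (snd x) - ln (fst x)"

lemma log_slope_log_point [simp]: "log_slope (log_point a s) = s"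
  by (simp add: log_slope_def log_point_def)

lemma log_point_cases:
  assumes "fst x > 0" "snd x > 0"
  shows "x = log_point (ln (fst x)) (log_slope x)"
  using assms by (simp add: log_point_def log_slope_def prod_eq_iff)

locale interior_equilibrium =
  fixes \<theta>\<^sub>1 \<theta>\<^sub>2 :: real
  assumes pos: "\<theta>\<^sub>1 > 0" "\<theta>\<^sub>2 > 0" and less: "\<theta>\<^sub>1 < 2 * \<theta>\<^sub>2" "\<theta>\<^sub>2 < 2 * \<theta>\<^sub>1"
begin

text \<open>The slope \<open>x\<^sub>2 / x\<^sub>1\<close> of the equilibrium.\<close>

definition r where "r = (2 * \<theta>\<^sub>2 - \<theta>\<^sub>1) / (2 * \<theta>\<^sub>1 - \<theta>\<^sub>2)"

lemma r_pos: "r > 0"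
  using less by (simp add: r_def)

text \<open>On the ray of slope \<open>r\<close> the map multiplies both coordinates by the same
  factor; the two sides are these factors divided by \<open>x\<^sub>1 / 2\<close>.\<close>

lemma r_eq: "\<theta>\<^sub>2 * (r + 2) = \<theta>\<^sub>1 * (1 + 2 * r)"
  using less by (simp add: r_def field_simps)

definition \<phi> where "\<phi> s = ln (\<theta>\<^sub>1 / 2 * (1 + 2 * exp s))"

definition \<phi>' :: "real \<Rightarrow> real" where "\<phi>' s = 2 * exp s / (1 + 2 * exp s)"

definition h where "h s = s + ln (\<theta>\<^sub>2 * (exp s + 2)) - ln (\<theta>\<^sub>1 * (1 + 2 * exp s))"

definition h' :: "real \<Rightarrow> real" where
  "h' s = 1 - 3 * exp s / ((exp s + 2) * (1 + 2 * exp s))"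

lemma one_plus_exp_pos: "0 < 1 + 2 * exp (s::real)"
  by (simp add: add_pos_pos)

lemma exp_plus_two_pos: "0 < exp (s::real) + 2"
  by (simp add: add_pos_pos)

lemma \<phi>_deriv: "(\<phi> has_real_derivative \<phi>' s) (at s)"
  unfolding \<phi>_def \<phi>'_def
  using pos one_plus_exp_pos[of s]
  by (auto intro!: derivative_eq_intros simp: divide_simps)

lemma h_deriv: "(h has_real_derivative h' s) (at s)"
  unfolding h_def h'_def
  using pos one_plus_exp_pos[of s] exp_plus_two_pos[of s]
  by (auto intro!: derivative_eq_intros simp: divide_simps) (simp add: algebra_simps)

lemma \<phi>'_cont: "continuous_on UNIV \<phi>'"
  unfolding \<phi>'_def using one_plus_exp_pos by (intro continuous_intros) (auto simp: less_imp_neq[symmetric])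

lemma h'_cont: "continuous_on UNIV h'"
  unfolding h'_def using one_plus_exp_pos exp_plus_two_pos
  by (intro continuous_intros) (auto simp: less_imp_neq[symmetric])

lemma \<phi>'_bound: "\<bar>\<phi>' s\<bar> \<le> 1"
  using one_plus_exp_pos[of s] by (simp add: \<phi>'_def)

text \<open>The denominator expands to \<open>2 * exp (2 * s) + 5 * exp s + 2\<close>, which exceeds
  the numerator \<open>3 * exp s\<close>, so the subtracted fraction lies strictly between 0 and
  1.\<close>

lemma h'_bound: "\<bar>h' s\<bar> < 1"
proof -
  have "0 < 3 * exp s / ((exp s + 2) * (1 + 2 * exp s))"
    by (intro divide_pos_pos mult_pos_pos one_plus_exp_pos exp_plus_two_pos) auto
  moreover have "3 * exp s / ((exp s + 2) * (1 + 2 * exp s)) < 1"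
    using one_plus_exp_pos[of s] exp_plus_two_pos[of s]
    by (simp add: divide_simps) (simp add: algebra_simps add_pos_pos)
  ultimately show ?thesis by (simp add: h'_def)
qed

lemma h_fixed: "h (ln r) = ln r"
  using r_pos r_eq by (simp add: h_def)

text \<open>Taking \<open>x\<^sub>1\<close> squared out of both coordinates leaves functions of the
  slope alone: hence \<open>2 * a\<close> in the first argument and no \<open>a\<close> in the
  second.\<close>

lemma H_log_point: "H \<theta>\<^sub>1 \<theta>\<^sub>2 (log_point a s) = log_point (2 * a + \<phi> s) (h s)"
proof -
  have "0 < \<theta>\<^sub>1 / 2 * (1 + 2 * exp s)"
    using pos(1) one_plus_exp_pos[of s] by simp
  then have exp_\<phi>: "exp (\<phi> s) = \<theta>\<^sub>1 / 2 * (1 + 2 * exp s)"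
    unfolding \<phi>_def by (rule exp_ln)
  have num: "0 < \<theta>\<^sub>2 * (exp s + 2)" and den: "0 < \<theta>\<^sub>1 * (1 + 2 * exp s)"
    by (intro mult_pos_pos pos one_plus_exp_pos exp_plus_two_pos)+
  have "exp (h s) = exp s * (\<theta>\<^sub>2 * (exp s + 2)) / (\<theta>\<^sub>1 * (1 + 2 * exp s))"
    unfolding h_def exp_diff exp_add exp_ln[OF num] exp_ln[OF den] ..
  then have exp_\<phi>_h: "exp (\<phi> s) * exp (h s) = exp s * (\<theta>\<^sub>2 * (exp s + 2)) / 2"
    using pos(1) one_plus_exp_pos[of s] unfolding exp_\<phi> by (simp add: divide_simps mult.commute)
  have "exp (2 * a + \<phi> s) = exp a * exp a * (\<theta>\<^sub>1 / 2 * (1 + 2 * exp s))"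
    by (simp only: exp_add mult_2 mult.assoc exp_\<phi>)
  moreover have "exp (2 * a + \<phi> s + h s) = exp a * exp a * (exp s * (\<theta>\<^sub>2 * (exp s + 2)) / 2)"
    by (simp only: exp_add mult_2 mult.assoc flip: exp_\<phi>_h)
  ultimately show ?thesis
    unfolding log_point_def H_def by (simp add: exp_add[of a s]) (simp add: algebra_simps)
qed

text \<open>A fixed point of the skew product over \<open>s = ln r\<close> must satisfy
  \<open>a = 2 * a + \<phi> (ln r)\<close>.\<close>

lemma E_bar_eq: "E_bar \<theta>\<^sub>1 \<theta>\<^sub>2 = log_point (- \<phi> (ln r)) (ln r)"
proof -
  have E: "fst (E_bar \<theta>\<^sub>1 \<theta>\<^sub>2) = inverse (\<theta>\<^sub>1 / 2 * (1 + 2 * r))"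
    "snd (E_bar \<theta>\<^sub>1 \<theta>\<^sub>2) = inverse (\<theta>\<^sub>1 / 2 * (1 + 2 * r)) * r"
    using pos less by (simp_all add: E_bar_def r_def divide_simps) (simp_all add: algebra_simps)
  have "0 < \<theta>\<^sub>1 / 2 * (1 + 2 * r)"
    using pos r_pos by simp
  then have "\<theta>\<^sub>1 / 2 * (1 + 2 * r) = exp (\<phi> (ln r))"
    using r_pos by (simp add: \<phi>_def)
  note E [unfolded this]
  then show ?thesis
    using r_pos by (simp add: prod_eq_iff log_point_def exp_add exp_minus del: add_uminus_conv_diff uminus_add_conv_diff)
qed

lemma E_bar_fixed: "H \<theta>\<^sub>1 \<theta>\<^sub>2 (E_bar \<theta>\<^sub>1 \<theta>\<^sub>2) = E_bar \<theta>\<^sub>1 \<theta>\<^sub>2"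
  by (simp add: E_bar_eq H_log_point h_fixed)

section \<open>The saddle property\<close>

lemma saddle: "saddle_fixed_point (H \<theta>\<^sub>1 \<theta>\<^sub>2) (E_bar \<theta>\<^sub>1 \<theta>\<^sub>2)"
proof -
  obtain e\<^sub>1 e\<^sub>2 where E: "E_bar \<theta>\<^sub>1 \<theta>\<^sub>2 = (e\<^sub>1, e\<^sub>2)" by fastforce
  have e: "e\<^sub>1 = (4 * \<theta>\<^sub>1 - 2 * \<theta>\<^sub>2) / (3 * \<theta>\<^sub>1 * \<theta>\<^sub>2)" "e\<^sub>2 = (4 * \<theta>\<^sub>2 - 2 * \<theta>\<^sub>1) / (3 * \<theta>\<^sub>1 * \<theta>\<^sub>2)"
    using E by (auto simp: E_bar_def)
  define L where "L = (\<lambda>(u, v). (\<theta>\<^sub>1 * ((e\<^sub>1 + e\<^sub>2) * u + e\<^sub>1 * v), \<theta>\<^sub>2 * (e\<^sub>2 * u + (e\<^sub>1 + e\<^sub>2) * v)))"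
  \<comment> \<open>The trace of \<open>L\<close> minus the eigenvalue 2 found below.\<close>
  define \<alpha> where "\<alpha> = (2 * \<theta>\<^sub>1\<^sup>2 - 2 * \<theta>\<^sub>1 * \<theta>\<^sub>2 + 2 * \<theta>\<^sub>2\<^sup>2) / (3 * \<theta>\<^sub>1 * \<theta>\<^sub>2)"
  have deriv: "(H \<theta>\<^sub>1 \<theta>\<^sub>2 has_derivative L) (at (e\<^sub>1, e\<^sub>2))"
    unfolding H_def L_def case_prod_beta
    by (auto intro!: derivative_eq_intros simp: algebra_simps)
  have "\<theta>\<^sub>1\<^sup>2 + \<theta>\<^sub>2\<^sup>2 - \<theta>\<^sub>1 * \<theta>\<^sub>2 > 0"
  proof -
    have "\<theta>\<^sub>1\<^sup>2 + \<theta>\<^sub>2\<^sup>2 - \<theta>\<^sub>1 * \<theta>\<^sub>2 = (\<theta>\<^sub>1 - \<theta>\<^sub>2)\<^sup>2 + \<theta>\<^sub>1 * \<theta>\<^sub>2"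
      by (simp add: power2_eq_square algebra_simps)
    then show ?thesis using pos by (metis add_nonneg_pos mult_pos_pos zero_le_power2)
  qed
  \<comment> \<open>Up to the positive denominator, this product is \<open>1 - \<alpha>\<close>,
    while the previous expression is \<open>\<alpha> / 2\<close>.\<close>
  moreover have "(2 * \<theta>\<^sub>1 - \<theta>\<^sub>2) * (2 * \<theta>\<^sub>2 - \<theta>\<^sub>1) > 0"
    using less by simp
  ultimately have \<alpha>: "\<bar>\<alpha>\<bar> < 1"
    using pos by (simp add: \<alpha>_def abs_less_iff divide_simps) (simp add: algebra_simps power2_eq_square)
  have v: "L (1, - (\<theta>\<^sub>2 / \<theta>\<^sub>1)) = \<alpha> *\<^sub>R (1, - (\<theta>\<^sub>2 / \<theta>\<^sub>1))"
    using pos by (simp add: L_def \<alpha>_def e divide_simps) (simp add: algebra_simps power2_eq_square)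
  \<comment> \<open>Euler's relation: for \<open>H\<close> homogeneous of degree 2, the derivative
    at a point sends that point to twice its image, and here the image is the point itself.\<close>
  have w: "L (e\<^sub>1, e\<^sub>2) = 2 *\<^sub>R (e\<^sub>1, e\<^sub>2)"
    using E_bar_fixed by (simp add: E L_def H_def algebra_simps)
  have "(e\<^sub>1, e\<^sub>2) \<noteq> 0" "(1, - (\<theta>\<^sub>2 / \<theta>\<^sub>1)) \<noteq> 0"
    using less pos by (auto simp: e zero_prod_def)
  with deriv \<alpha> v w E_bar_fixed show ?thesis
    unfolding saddle_fixed_point_def E
    by (metis abs_numeral one_less_numeral_iff semiring_norm(76))
qed

section \<open>The stable curve and its tangent\<close>

lemma tangent:
  "tangent_vector_of_curve
     (stable_curve quadrant (H \<theta>\<^sub>1 \<theta>\<^sub>2) (E_bar \<theta>\<^sub>1 \<theta>\<^sub>2)) (E_bar \<theta>\<^sub>1 \<theta>\<^sub>2) (1, - (\<theta>\<^sub>2 / \<theta>\<^sub>1))"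
proof -
  obtain A A' where A: "\<And>s. (A has_real_derivative A' s) (at s)" "continuous_on UNIV A'"
    "\<And>s. A (h s) = 2 * A s + \<phi> s"
    using cohomological_equation[OF h_deriv h'_cont less_imp_le[OF h'_bound] \<phi>_deriv \<phi>'_cont
        \<phi>'_bound h_fixed] by blast
  have A_cont: "continuous_on UNIV A"
    by (intro continuous_at_imp_continuous_on ballI DERIV_isCont[OF A(1)])
  have E: "E_bar \<theta>\<^sub>1 \<theta>\<^sub>2 = log_point (A (ln r)) (ln r)"
    using A(3)[of "ln r"] by (simp add: E_bar_eq h_fixed eq_neg_iff_add_eq_0[symmetric])
  \<comment> \<open>\<open>d\<close> is the displacement from the graph of \<open>A\<close>.\<close>
  have iter: "(H \<theta>\<^sub>1 \<theta>\<^sub>2 ^^ k) (log_point (A s + d) s) = log_point (A ((h ^^ k) s) + 2 ^ k * d) ((h ^^ k) s)"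
    for k s d
    by (induction k) (simp_all add: H_log_point A(3) algebra_simps)
  have conv: "(\<lambda>k. (h ^^ k) s) \<longlonglongrightarrow> ln r" for s
    by (rule funpow_tendsto_fixed_point[OF h_deriv h'_cont h'_bound h_fixed])
  have A_conv: "(\<lambda>k. A ((h ^^ k) s)) \<longlonglongrightarrow> A (ln r)" for s
    by (rule continuous_on_tendsto_compose[OF A_cont conv]) auto
  let ?C = "stable_curve quadrant (H \<theta>\<^sub>1 \<theta>\<^sub>2) (E_bar \<theta>\<^sub>1 \<theta>\<^sub>2)"
  have stable_iff: "log_point a s \<in> ?C \<longleftrightarrow> a = A s" for a s
  proof
    assume "a = A s"
    with iter[of _ s 0] have "(H \<theta>\<^sub>1 \<theta>\<^sub>2 ^^ k) (log_point a s) = log_point (A ((h ^^ k) s)) ((h ^^ k) s)" for k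
      by simp
    then show "log_point a s \<in> ?C"
      unfolding stable_curve_def E
      by (auto simp: quadrant_def log_point_def intro!: tendsto_intros A_conv conv)
  next
    assume "log_point a s \<in> ?C"
    then have "(\<lambda>k. log_point (A ((h ^^ k) s) + 2 ^ k * (a - A s)) ((h ^^ k) s)) \<longlonglongrightarrow> log_point (A (ln r)) (ln r)"
      using iter[of _ s "a - A s"] by (simp add: stable_curve_def E)
    from tendsto_ln[OF tendsto_fst[OF this]]
    have "(\<lambda>k. A ((h ^^ k) s) + 2 ^ k * (a - A s)) \<longlonglongrightarrow> A (ln r)"
      by (simp add: log_point_def)
    from tendsto_diff[OF this A_conv[of s]] have "(\<lambda>k. 2 ^ k * (a - A s)) \<longlonglongrightarrow> 0"
      by simp
    \<comment> \<open>The product is constantly \<open>a - A s\<close>, so its limit 0 forces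
      equality.\<close>
    then have "(\<lambda>k. (1/2) ^ k * (2 ^ k * (a - A s))) \<longlonglongrightarrow> 0 * 0"
      by (intro tendsto_mult LIMSEQ_power_zero) auto
    then show "a = A s"
      by (simp add: power_one_over LIMSEQ_const_iff)
  qed
  \<comment> \<open>The graph of \<open>A\<close> is global, so the half-width 1 is an arbitrary
    choice.\<close>
  define I :: "real set" where "I = {-1<..<1}"
  define \<gamma> where "\<gamma> t = log_point (A (ln r + t)) (ln r + t)" for t
  define \<gamma>' where "\<gamma>' t = (exp (A (ln r + t)) * A' (ln r + t),
    exp (A (ln r + t) + (ln r + t)) * (A' (ln r + t) + 1))" for t
  define \<delta> where "\<delta> x = log_slope x - ln r" for x
  \<comment> \<open>\<open>Q\<close> leaves out the axes, where the logarithms lose their meaning.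
    \<open>U\<close> is then an open sector around the ray of slope \<open>r\<close>, in which the
    stable curve is exactly the arc over \<open>I\<close>.\<close>
  define Q :: "(real \<times> real) set" where "Q = {0<..} \<times> {0<..}"
  define U where "U = Q \<inter> \<delta> -` I"
  have \<delta>_cont: "continuous_on Q \<delta>"
    unfolding \<delta>_def log_slope_def Q_def by (intro continuous_intros) auto
  have "open Q"
    unfolding Q_def by (intro open_Times) auto
  then have "open U"
    unfolding U_def by (rule continuous_open_preimage[OF \<delta>_cont]) (simp add: I_def)
  have shift: "((\<lambda>t. A (ln r + t)) has_real_derivative A' (ln r + t)) (at t)" for t
    by (rule DERIV_chain2[where g = "\<lambda>t. ln r + t" and Db = 1, OF A(1), simplified])
       (auto intro!: derivative_eq_intros)
  have \<gamma>_deriv: "(\<gamma> has_vector_derivative \<gamma>' t) (at t)" for t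
    unfolding \<gamma>_def log_point_def \<gamma>'_def
    by (intro has_vector_derivative_Pair)
       (auto intro!: derivative_eq_intros shift simp: has_real_derivative_iff_has_vector_derivative[symmetric])
  have \<gamma>_cont: "continuous_on S \<gamma>" for S
    by (intro continuous_at_imp_continuous_on ballI has_vector_derivative_continuous[OF \<gamma>_deriv])
  have "continuous_on I \<gamma>'"
    unfolding \<gamma>'_def
    by (intro continuous_intros continuous_on_compose2[OF A(2)] continuous_on_compose2[OF A_cont]) auto
  with \<gamma>_deriv have C1: "\<gamma> C1_differentiable_on I"
    unfolding C1_differentiable_on_def by blast
  have \<delta>\<gamma>: "\<delta> (\<gamma> t) = t" for t
    by (simp add: \<delta>_def \<gamma>_def)
  have \<gamma>_mem: "\<gamma> t \<in> ?C \<inter> U" if "t \<in> I" for t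
    using that stable_iff by (auto simp: U_def \<delta>\<gamma>) (auto simp: \<gamma>_def Q_def log_point_def)
  have \<gamma>\<delta>: "\<gamma> (\<delta> x) = x" if "x \<in> ?C \<inter> U" for x
  proof -
    have x: "x = log_point (ln (fst x)) (log_slope x)"
      using that by (intro log_point_cases) (auto simp: U_def Q_def)
    with that have "ln (fst x) = A (log_slope x)"
      using stable_iff by (metis IntD1)
    with x show ?thesis by (simp add: \<gamma>_def \<delta>_def)
  qed
  have homeo: "homeomorphism I (?C \<inter> U) \<gamma> \<delta>"
  proof (rule homeomorphismI)
    show "continuous_on (?C \<inter> U) \<delta>"
      by (rule continuous_on_subset[OF \<delta>_cont]) (auto simp: U_def)
  qed (use \<gamma>_cont \<gamma>_mem \<delta>\<gamma> \<gamma>\<delta> in \<open>auto simp: U_def\<close>)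
  have vd: "vector_derivative \<gamma> (at t) = \<gamma>' t" for t
    by (rule vector_derivative_at[OF \<gamma>_deriv])
  \<comment> \<open>The components could vanish together only if \<open>A'\<close> were both 0 and
    -1.\<close>
  have nz: "\<gamma>' t \<noteq> 0" for t
    by (simp add: \<gamma>'_def zero_prod_def)
  \<comment> \<open>Both sides of the functional equation are differentiated at the fixed point,
    which determines \<open>A' (ln r)\<close>.\<close>
  have "A' (ln r) * h' (ln r) = 2 * A' (ln r) + \<phi>' (ln r)"
  proof (rule DERIV_unique)
    show "((\<lambda>s. A (h s)) has_real_derivative A' (ln r) * h' (ln r)) (at (ln r))"
      by (rule DERIV_chain2[OF _ h_deriv]) (simp add: h_fixed A(1))
    show "((\<lambda>s. A (h s)) has_real_derivative 2 * A' (ln r) + \<phi>' (ln r)) (at (ln r))"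
      unfolding A(3) by (auto intro!: derivative_eq_intros A(1) \<phi>_deriv)
  qed
  then have "A' (ln r) * (1 - 3 * r / ((r + 2) * (1 + 2 * r))) = 2 * A' (ln r) + 2 * r / (1 + 2 * r)"
    using r_pos by (simp add: h'_def \<phi>'_def)
  then have "A' (ln r) * (r\<^sup>2 + 4 * r + 1) = - (r * (r + 2))"
    using r_pos by (simp add: divide_simps) (simp add: algebra_simps power2_eq_square)
  moreover have "r\<^sup>2 + 4 * r + 1 > 0"
    using r_pos by (simp add: add_pos_pos)
  ultimately have A'_eq: "A' (ln r) = - (r * (r + 2) / (r\<^sup>2 + 4 * r + 1))"
    by (simp add: field_simps)
  have "\<theta>\<^sub>2 / \<theta>\<^sub>1 = (1 + 2 * r) / (r + 2)"
    using r_eq pos r_pos by (simp add: divide_simps mult.commute)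
  \<comment> \<open>The slope of the tangent, where
    \<open>A' (ln r) + 1 = (1 + 2 * r) / (r\<^sup>2 + 4 * r + 1)\<close>; by \<open>r_eq\<close> it
    is the required ratio of parameters.\<close>
  moreover have ratio: "r * (A' (ln r) + 1) / A' (ln r) = - ((1 + 2 * r) / (r + 2))" "A' (ln r) \<noteq> 0"
    using r_pos \<open>r\<^sup>2 + 4 * r + 1 > 0\<close> unfolding A'_eq
    by (simp_all add: divide_simps) (simp_all add: algebra_simps power2_eq_square)
  moreover have "\<gamma>' 0 = (exp (A (ln r)) * A' (ln r)) *\<^sub>R (1, r * (A' (ln r) + 1) / A' (ln r))"
    using r_pos ratio(2) by (simp add: \<gamma>'_def exp_add)
  ultimately have "(1, - (\<theta>\<^sub>2 / \<theta>\<^sub>1)) = inverse (exp (A (ln r)) * A' (ln r)) *\<^sub>R \<gamma>' 0"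
    by (metis exp_not_eq_zero left_inverse mult_eq_0_iff scaleR_one scaleR_scaleR)
  then have dir: "\<exists>c. (1, - (\<theta>\<^sub>2 / \<theta>\<^sub>1)) = c *\<^sub>R vector_derivative \<gamma> (at 0)"
    unfolding vd by (rule exI)
  have reg: "\<forall>t\<in>I. vector_derivative \<gamma> (at t) \<noteq> 0"
    unfolding vd using nz by blast
  have base: "\<gamma> 0 = E_bar \<theta>\<^sub>1 \<theta>\<^sub>2"
    by (simp add: \<gamma>_def E)
  show ?thesis
    unfolding tangent_vector_of_curve_def
  proof (rule exI[of _ 1], rule conjI[OF zero_less_one], rule exI[of _ \<gamma>], rule exI[of _ \<delta>],
      rule exI[of _ U], intro conjI)
  qed (fact \<open>open U\<close> homeo[unfolded I_def] C1[unfolded I_def] reg[unfolded I_def] base dir)+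
qed

end

theorem proposition13:
  fixes \<theta>\<^sub>1 \<theta>\<^sub>2 :: real
  assumes "\<theta>\<^sub>1 > 0" and "\<theta>\<^sub>2 > 0"
    and "\<theta>\<^sub>1 < 2 * \<theta>\<^sub>2" and "\<theta>\<^sub>2 < 2 * \<theta>\<^sub>1"
  shows "saddle_fixed_point (H \<theta>\<^sub>1 \<theta>\<^sub>2) (E_bar \<theta>\<^sub>1 \<theta>\<^sub>2) \<and>
    tangent_vector_of_curve
      (stable_curve quadrant (H \<theta>\<^sub>1 \<theta>\<^sub>2) (E_bar \<theta>\<^sub>1 \<theta>\<^sub>2)) (E_bar \<theta>\<^sub>1 \<theta>\<^sub>2) (1, - (\<theta>\<^sub>2 / \<theta>\<^sub>1))"
proof -
  interpret interior_equilibrium \<theta>\<^sub>1 \<theta>\<^sub>2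
    using assms by unfold_locales
  show ?thesis
    using saddle tangent by blast
qed

end
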